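(* Let $\ell$ and $m$ be positive integers with $3\nmid\ell$, and write $q:=2^m$ and $n:=\lfloor(q+1)/3\rfloor$. Let $a\in\mathbb{F}_q\setminus\mathbb{F}_2$ satisfy $\mathrm{Tr}(1/a)=\mathrm{Tr}(1)$, and let $N_\ell$ be the number of roots in $\mathbb{F}_{q^3}$ of $X^{2q^\ell+1}+X+a$. Then: (1) if $\ell\not\equiv -m\pmod 3$ then $N_\ell=3$; (2) if $\ell\equiv -m\pmod 3$ then $N_\ell\in\{0,9\}$, and $N_\ell=9$ if and only if $D_n(a)=0$.
   Context: $\mathrm{Tr}$ denotes the trace map from $\mathbb{F}_q$ to $\mathbb{F}_2$. For a positive integer $n$, $D_n(X)\in\mathbb{F}_2[X]$ is the Dickson polynomial of the first kind of degree $n$ with parameter $1$, i.e. the unique polynomial satisfying $D_n(X+X^{-1})=X^n+X^{-n}$. *)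

theory Defs
  imports
    "HOL-Algebra.Algebraic_Closure_Type"
    "HOL-Number_Theory.Cong"
    "HOL-Library.Z2"
begin

text \<open>The trace map to \<open>\<bbbF>\<^sub>2\<close> of a field with \<open>2 ^ m\<close> elements, as the sum of the conjugates.
  The argument \<open>x\<close> may live in a larger field, so the trace depends on \<open>m\<close>
  and its values are the elements 0 and 1 of that field.\<close>

definition trace2 :: "nat \<Rightarrow> 'a::field \<Rightarrow> 'a" where
  "trace2 m x = (\<Sum>i<m. x ^ (2 ^ i))"

text \<open>The indeterminate of the rational function field \<open>\<bbbF>\<^sub>2(X)\<close>, and the evaluation at an element
  of \<open>\<bbbF>\<^sub>2(X)\<close> of a polynomial over \<open>\<bbbF>\<^sub>2\<close>.\<close>

definition ratX :: "bit poly fract" where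
  "ratX = to_fract [:0, 1:]"

definition rat_eval :: "bit poly \<Rightarrow> bit poly fract \<Rightarrow> bit poly fract" where
  "rat_eval D t = poly (map_poly (\<lambda>c. to_fract [:c:]) D) t"

definition dickson_poly :: "nat \<Rightarrow> bit poly" where
  "dickson_poly n = (THE D. rat_eval D (ratX + inverse ratX) = ratX ^ n + inverse ratX ^ n)"

lemma ratX_nonzero: "ratX \<noteq> 0"
  by (simp add: ratX_def)

lemma rat_eval_conv_sum:
  assumes "degree D \<le> d"
  shows "rat_eval D t = (\<Sum>i\<le>d. to_fract [:Polynomial.coeff D i:] * t ^ i)"
proof -
  have "degree (map_poly (\<lambda>c. to_fract [:c:]) D) \<le> d"
    using assms by (intro degree_le) (simp add: coeff_map_poly coeff_eq_0)
  then have "poly (map_poly (\<lambda>c. to_fract [:c:]) D) t =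
      (\<Sum>i\<le>d. Polynomial.coeff (map_poly (\<lambda>c. to_fract [:c:]) D) i * t ^ i)"
    unfolding poly_altdef by (intro sum.mono_neutral_left) (auto simp: coeff_eq_0)
  then show ?thesis
    by (simp add: rat_eval_def coeff_map_poly)
qed

lemma rat_eval_diff: "rat_eval (p - q) t = rat_eval p t - rat_eval q t"
proof -
  define d where "d = max (degree p) (degree q)"
  have "degree (p - q) \<le> d"
    by (simp add: d_def degree_diff_le)
  moreover have "to_fract [:a - b:] = to_fract [:a:] - to_fract [:b:]" for a b :: bit
    by (simp flip: to_fract_diff)
  ultimately show ?thesis
    by (simp add: rat_eval_conv_sum[of _ d] d_def left_diff_distrib sum_subtractf del: to_fract_diff)
qed

lemma rat_eval_pCons: "rat_eval (pCons c p) t = to_fract [:c:] + t * rat_eval p t"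
  by (simp add: rat_eval_def map_poly_pCons)

lemma rat_eval_0: "rat_eval 0 t = 0"
  by (simp add: rat_eval_def)

lemma rat_eval_1: "rat_eval [:1:] t = 1"
  by (simp add: rat_eval_pCons rat_eval_0) (simp flip: one_pCons)

lemma rat_eval_eq_0D:
  assumes "rat_eval D (ratX + inverse ratX) = 0"
  shows "D = 0"
proof -
  define d where "d = degree D"
  define P :: "bit poly" where
    "P = (\<Sum>i\<le>d. [:Polynomial.coeff D i:] * ([:0, 1:] ^ (d - i) * ([:0, 1:] ^ 2 + 1) ^ i))"
  have pw: "to_fract (x ^ k) = to_fract x ^ k" for x :: "bit poly" and k
    by (induction k) simp_all
  have "to_fract P =
      (\<Sum>i\<le>d. to_fract [:Polynomial.coeff D i:] * (ratX ^ (d - i) * (ratX ^ 2 + 1) ^ i))"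
    by (simp add: P_def pw ratX_def del: mult_pCons_left)
  also have "\<dots> = (\<Sum>i\<le>d. ratX ^ d * (to_fract [:Polynomial.coeff D i:] * (ratX + inverse ratX) ^ i))"
  proof (rule sum.cong[OF refl])
    fix i assume "i \<in> {..d}"
    then have "ratX ^ d = ratX ^ (d - i) * ratX ^ i"
      by (simp flip: power_add)
    moreover have "ratX ^ 2 + 1 = ratX * (ratX + inverse ratX)"
      using ratX_nonzero by (simp add: power2_eq_square distrib_left)
    ultimately show "to_fract [:Polynomial.coeff D i:] * (ratX ^ (d - i) * (ratX ^ 2 + 1) ^ i) =
        ratX ^ d * (to_fract [:Polynomial.coeff D i:] * (ratX + inverse ratX) ^ i)"
      by (simp add: power_mult_distrib mult_ac)
  qed
  also have "\<dots> = ratX ^ d * rat_eval D (ratX + inverse ratX)"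
    by (simp add: rat_eval_conv_sum[of D d] d_def sum_distrib_left)
  finally have "P = 0"
    using assms by simp
  then have "0 = poly P 0"
    by simp
  also have "\<dots> = (\<Sum>i\<le>d. if i = d then Polynomial.coeff D i else 0)"
    unfolding P_def poly_sum by (intro sum.cong) (auto simp: power_0_left)
  also have "\<dots> = Polynomial.coeff D (degree D)"
    by (simp add: d_def)
  finally show ?thesis
    by (metis leading_coeff_0_iff)
qed

lemma dickson_poly_ex1:
  "\<exists>!D. rat_eval D (ratX + inverse ratX) = ratX ^ n + inverse ratX ^ n"
proof (rule ex_ex1I)
  have "(\<exists>D. rat_eval D (ratX + inverse ratX) = ratX ^ n + inverse ratX ^ n) \<and>
        (\<exists>D. rat_eval D (ratX + inverse ratX) = ratX ^ Suc n + inverse ratX ^ Suc n)"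
  proof (induction n)
    case 0
    have "rat_eval 0 (ratX + inverse ratX) = ratX ^ 0 + inverse ratX ^ 0"
    proof -
      have "(1 + 1 :: bit poly fract) = to_fract ([:1:] + [:1:])"
        by (simp only: to_fract_add to_fract_1 flip: one_pCons)
      also have "[:1:] + [:1:] = (0 :: bit poly)"
        by simp
      finally show ?thesis
        by (simp add: rat_eval_0)
    qed
    moreover have "rat_eval [:0, 1:] (ratX + inverse ratX) = ratX ^ Suc 0 + inverse ratX ^ Suc 0"
      by (simp add: rat_eval_pCons[of 0] rat_eval_1)
    ultimately show ?case by blast
  next
    case (Suc n)
    then obtain D E where
      D: "rat_eval D (ratX + inverse ratX) = ratX ^ n + inverse ratX ^ n" and
      E: "rat_eval E (ratX + inverse ratX) = ratX ^ Suc n + inverse ratX ^ Suc n"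
      by blast
    have "rat_eval (pCons 0 E - D) (ratX + inverse ratX) =
        (ratX + inverse ratX) * (ratX ^ Suc n + inverse ratX ^ Suc n) - (ratX ^ n + inverse ratX ^ n)"
      by (simp add: rat_eval_diff rat_eval_pCons D E)
    also have "\<dots> = ratX ^ Suc (Suc n) + inverse ratX ^ Suc (Suc n)"
      using ratX_nonzero by (simp add: field_simps)
    finally show ?case using Suc by blast
  qed
  then show "\<exists>D. rat_eval D (ratX + inverse ratX) = ratX ^ n + inverse ratX ^ n" ..
next
  fix D E
  assume "rat_eval D (ratX + inverse ratX) = ratX ^ n + inverse ratX ^ n"
    and "rat_eval E (ratX + inverse ratX) = ratX ^ n + inverse ratX ^ n"
  then have "rat_eval (D - E) (ratX + inverse ratX) = 0"
    by (simp add: rat_eval_diff)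
  then show "D = E"
    using rat_eval_eq_0D by fastforce
qed

end

theory Submission
  imports Defs "HOL-Number_Theory.Residues"
begin

text \<open>Let \<open>\<sigma>\<close> be the \<open>q\<^sup>l\<close>-power map; the equation reads \<open>x = a / (\<sigma> x + 1)\<^sup>2\<close>. The map
  \<open>y \<mapsto> a / (y + 1)\<^sup>2\<close> is a Moebius map composed with squaring, and its fixed points are the three
  roots of \<open>X\<^sup>3 + X + a\<close>. In the coordinate \<open>w\<close> that puts these at \<open>0\<close>, \<open>\<infinity>\<close>, \<open>1\<close> it is squaring.
  If \<open>\<sigma>\<close> fixes the three roots, the equation becomes \<open>w = \<sigma>(w)\<^sup>2\<close>; if it permutes them cyclically,
  it becomes \<open>\<sigma>(w)\<^sup>2 (1 + w) = 1\<close>. Either way \<open>w\<close> lies in \<open>\<bbbF>\<^sub>8\<close> (or \<open>w = \<infinity>\<close>), where the solutions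
  can be counted by hand.

  To tell the two cases apart write \<open>a = t + 1/t\<close>. The roots of the cubic are \<open>v + 1/v\<close> with
  \<open>v\<^sup>3 = t\<close>, the trace condition says \<open>t ^ q = t\<close> for even and \<open>t ^ q = 1/t\<close> for odd \<open>m\<close>, and the
  \<open>q\<close>-power map multiplies \<open>v\<close> (up to inversion) by the cube root of unity \<open>t ^ n\<close>. So the roots
  are fixed if \<open>t ^ n = 1\<close>, that is \<open>D\<^sub>n(a) = t ^ n + 1/t ^ n = 0\<close>, and cyclically permuted otherwise.\<close>

section \<open>Arithmetic in characteristic two\<close>

lemma two_eq_0_char2: "CHAR('a::ring_1) = 2 \<Longrightarrow> (2::'a) = 0"
  using of_nat_CHAR[where 'a='a] by simp

text \<open>As rewrite rules these reduce numeral coefficients modulo 2. Together with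
  \<open>char2_expand\<close> they settle polynomial identities in characteristic two by
  expansion.\<close>

lemma numeral_char2:
  assumes "CHAR('a::comm_ring_1) = 2"
  shows "numeral (num.Bit0 k) = (0::'a)" "numeral (num.Bit1 k) = (1::'a)"
proof -
  have "numeral (num.Bit0 k) = (2::'a) * numeral k" "numeral (num.Bit1 k) = (2::'a) * numeral k + 1"
    by (simp_all only: numeral_Bit0 numeral_Bit1 numeral_One distrib_right mult_1)
  then show "numeral (num.Bit0 k) = (0::'a)" "numeral (num.Bit1 k) = (1::'a)"
    by (simp_all only: two_eq_0_char2[OF assms] mult_zero_left add_0)
qed

lemmas char2_expand =
  algebra_simps power_numeral_even power_numeral_odd power2_eq_square power3_eq_cube Let_def

lemma add_eq_0_char2:
  assumes "CHAR('a::ring_1) = 2"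
  shows "x + y = 0 \<longleftrightarrow> x = (y::'a)"
  using minus_CHAR_2[OF assms, of x y] by (metis eq_iff_diff_eq_0)

lemma frobenius_add:
  assumes "CHAR('a::field) = 2"
  shows "(x + y :: 'a) ^ (2 ^ k) = x ^ (2 ^ k) + y ^ (2 ^ k)"
  by (rule freshmans_dream'[where n = k]) (simp_all add: assms)

text \<open>The left side is \<open>mob x + (mob y)^2\<close> with denominators cleared. For roots
  \<open>r\<close>, \<open>s\<close> of the cubic, Vieta's relations turn the right side into
  \<open>a * (x * (y^2 + 1) + a)\<close>.\<close>

lemma mobius_identity:
  fixes x y r s :: "'a::field"
  assumes "CHAR('a) = 2"
  shows "r * (x + r) * (s * (y + s))^2 + s * (x + s) * (r * (y + r))^2
    = r * s * (r + s) * (x * (y^2 + (r^2 + r * s + s^2)) + r * s * (r + s))"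
  by (simp add: char2_expand numeral_char2[OF assms])

section \<open>The field with eight elements\<close>

lemma power_2_power_mod_3:
  fixes w :: "'a::monoid_mult"
  assumes "w ^ 8 = w"
  shows "w ^ (2 ^ k) = w ^ (2 ^ (k mod 3))"
proof -
  have *: "w ^ (8 ^ i) = w" for i
    by (induction i) (simp_all add: assms power_mult)
  have "(2::nat) ^ k = 2 ^ (3 * (k div 3) + k mod 3)"
    by (simp only: mult_div_mod_eq)
  also have "\<dots> = 8 ^ (k div 3) * 2 ^ (k mod 3)"
    by (simp only: power_add power_mult) simp
  finally show ?thesis
    by (simp add: power_mult *)
qed

text \<open>This is the factorization of \<open>X^8 + X\<close> into irreducibles over the field
  with two elements.\<close>

lemma power_8_factors_char2:
  fixes w :: "'a::field"
  assumes ch: "CHAR('a) = 2"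
  shows "w ^ 8 + w = w * ((w + 1) * ((w^3 + w + 1) * (w^3 + w^2 + 1)))"
proof -
  have "(w^3 + w + 1) * (w^3 + w^2 + 1) = w^6 + w^5 + w^4 + w^3 + w^2 + w + 1"
    by (simp add: char2_expand numeral_char2[OF ch])
  moreover have "w * ((w + 1) * (w^6 + w^5 + w^4 + w^3 + w^2 + w + 1)) = w^8 + w"
    by (simp add: char2_expand numeral_char2[OF ch])
  ultimately show ?thesis by simp
qed

lemma power_8_eq_self_iff_char2:
  fixes w :: "'a::field"
  assumes ch: "CHAR('a) = 2"
  shows "w ^ 8 = w \<longleftrightarrow> w = 0 \<or> w = 1 \<or> w^3 = w + 1 \<or> w^3 = w^2 + 1"
proof -
  have "w ^ 8 = w \<longleftrightarrow> w ^ 8 + w = 0"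
    by (simp add: add_eq_0_char2[OF ch])
  also have "\<dots> \<longleftrightarrow> w = 0 \<or> w + 1 = 0 \<or> w^3 + (w + 1) = 0 \<or> w^3 + (w^2 + 1) = 0"
    by (simp add: power_8_factors_char2[OF ch] add.assoc)
  finally show ?thesis
    by (simp only: add_eq_0_char2[OF ch])
qed

text \<open>The roots are the conjugates \<open>z\<close>, \<open>z^2\<close> and
  \<open>z^4 = z^2 + z\<close>.\<close>

lemma roots_cubic_char2:
  fixes z :: "'a::field"
  assumes ch: "CHAR('a) = 2" and z: "z^3 = z + 1"
  shows "{w. w^3 = w + 1} = {z, z^2, z^2 + z}" and "card {w::'a. w^3 = w + 1} = 3"
proof -
  have z0: "z \<noteq> 0" "z \<noteq> 1"
    using z by (auto simp: numeral_char2[OF ch])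
  have z': "z^3 + (z + 1) = 0"
    using z by (simp only: add_eq_0_char2[OF ch])
  \<comment> \<open>The product differs from the cubic in \<open>w\<close> by a multiple of the
    cubic in \<open>z\<close>, which vanishes.\<close>
  have "(w + z) * ((w + z^2) * (w + (z^2 + z))) = w^3 + (w + 1) + (z^3 + (z + 1)) * (w * (z + 1) + (z^2 + z + 1))"
    for w
    by (simp add: char2_expand numeral_char2[OF ch])
  then have "w^3 + (w + 1) = 0 \<longleftrightarrow> w + z = 0 \<or> w + z^2 = 0 \<or> w + (z^2 + z) = 0" for w
    by (simp only: z' mult_zero_left add_0_right flip: mult_eq_0_iff)
  then show eq: "{w. w^3 = w + 1} = {z, z^2, z^2 + z}"
    by (auto simp only: add_eq_0_char2[OF ch] insert_iff mem_Collect_eq empty_iff)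
  show "card {w::'a. w^3 = w + 1} = 3"
    unfolding eq using z0 by (simp add: power2_eq_square)
qed

text \<open>The involution \<open>w \<mapsto> w + 1\<close> exchanges the roots of the two
  cubics.\<close>

lemma card_dual_cubic_char2:
  fixes z :: "'a::field"
  assumes ch: "CHAR('a) = 2" and z: "z^3 = z + 1"
  shows "card {w::'a. w^3 = w^2 + 1} = 3"
proof -
  have id: "(w + 1)^3 + ((w + 1) + 1) = w^3 + (w^2 + 1)" for w :: 'a
    by (simp add: char2_expand numeral_char2[OF ch])
  have iff: "w^3 = w^2 + 1 \<longleftrightarrow> (w + 1)^3 = (w + 1) + 1" for w :: 'a
    by (simp only: id flip: add_eq_0_char2[OF ch, of "w^3"] add_eq_0_char2[OF ch, of "(w + 1)^3"])
  have inv: "w + 1 + 1 = w" for w :: 'a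
    by (simp add: add.assoc numeral_char2[OF ch])
  have "{w::'a. w^3 = w + 1} = (\<lambda>w. w + 1) ` {w. w^3 = w^2 + 1}"
  proof (intro equalityI subsetI)
    fix w :: 'a assume "w \<in> {w. w^3 = w + 1}"
    then have "w + 1 \<in> {w. w^3 = w^2 + 1}"
      by (simp only: mem_Collect_eq iff inv)
    then have "(w + 1) + 1 \<in> (\<lambda>w. w + 1) ` {w. w^3 = w^2 + 1}"
      by (rule imageI)
    then show "w \<in> (\<lambda>w. w + 1) ` {w. w^3 = w^2 + 1}"
      by (simp only: inv)
  qed (auto simp only: iff)
  moreover have "inj_on (\<lambda>w. w + 1) {w::'a. w^3 = w^2 + 1}"
    by (simp add: inj_on_def)
  ultimately show ?thesis
    using roots_cubic_char2(2)[OF ch z] by (simp add: card_image)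
qed

text \<open>When the roots are permuted cyclically, the equation to solve is
  \<open>w ^ (2 ^ k) * (1 + w) = 1\<close> with \<open>k\<close> in {0, 1, 2}. Reducing modulo the
  cubic decides each exponent; the next lemma does the same for the other cubic.\<close>

lemma cubic_powers_char2:
  fixes w :: "'a::field"
  assumes ch: "CHAR('a) = 2" and "w^3 = w + 1"
  shows "w \<noteq> 0" "w \<noteq> 1" "w * (1 + w) \<noteq> 1" "w^2 * (1 + w) \<noteq> 1" "w^4 * (1 + w) = 1"
proof -
  have w: "w^3 + (w + 1) = 0"
    using assms(2) by (simp only: add_eq_0_char2[OF ch])
  show w0: "w \<noteq> 0" and w1: "w \<noteq> 1"
    using assms(2) by (auto simp: numeral_char2[OF ch])
  have "w * (1 + w) + 1 = (w^3 + (w + 1)) + w^2 * (1 + w)"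
    by (simp add: char2_expand numeral_char2[OF ch])
  moreover have "1 + w \<noteq> 0"
    using w1 by (auto simp: add_eq_0_char2[OF ch])
  ultimately have "w * (1 + w) + 1 \<noteq> 0"
    using w w0 by simp
  then show "w * (1 + w) \<noteq> 1"
    by (simp only: add_eq_0_char2[OF ch] not_False_eq_True)
  have "w^2 * (1 + w) + 1 = (w^3 + (w + 1)) + w * (1 + w)"
    by (simp add: char2_expand numeral_char2[OF ch])
  then have "w^2 * (1 + w) + 1 \<noteq> 0"
    using w w0 \<open>1 + w \<noteq> 0\<close> by simp
  then show "w^2 * (1 + w) \<noteq> 1"
    by (simp only: add_eq_0_char2[OF ch] not_False_eq_True)
  have "w^4 * (1 + w) + 1 = (w^3 + (w + 1)) * (w^2 + w + 1)"
    by (simp add: char2_expand numeral_char2[OF ch])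
  then have "w^4 * (1 + w) + 1 = 0"
    using w by simp
  then show "w^4 * (1 + w) = 1"
    by (simp only: add_eq_0_char2[OF ch])
qed

lemma dual_cubic_powers_char2:
  fixes w :: "'a::field"
  assumes ch: "CHAR('a) = 2" and "w^3 = w^2 + 1"
  shows "w \<noteq> 0" "w \<noteq> 1" "w * (1 + w) \<noteq> 1" "w^2 * (1 + w) = 1" "w^4 * (1 + w) \<noteq> 1"
proof -
  have w: "w^3 + (w^2 + 1) = 0"
    using assms(2) by (simp only: add_eq_0_char2[OF ch])
  show w0: "w \<noteq> 0" and w1: "w \<noteq> 1"
    using assms(2) by (auto simp: numeral_char2[OF ch])
  have "w * (1 + w) + 1 = (w^3 + (w^2 + 1)) + w * (w + 1)^2"
    by (simp add: char2_expand numeral_char2[OF ch])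
  moreover have "w + 1 \<noteq> 0"
    using w1 by (simp add: add_eq_0_char2[OF ch])
  ultimately have "w * (1 + w) + 1 \<noteq> 0"
    using w w0 by simp
  then show "w * (1 + w) \<noteq> 1"
    by (simp only: add_eq_0_char2[OF ch] not_False_eq_True)
  have "w^2 * (1 + w) + 1 = w^3 + (w^2 + 1)"
    by (simp add: char2_expand)
  then have "w^2 * (1 + w) + 1 = 0"
    using w by simp
  then show *: "w^2 * (1 + w) = 1"
    by (simp only: add_eq_0_char2[OF ch])
  have "w^4 * (1 + w) = w^2 * (w^2 * (1 + w))"
    by (simp add: char2_expand)
  also have "\<dots> = w^2"
    by (simp add: *)
  finally have "w^4 * (1 + w) = w^2" .
  moreover have "w^2 + 1 = (w + 1)^2"
    by (simp add: char2_expand numeral_char2[OF ch])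
  then have "w^2 + 1 \<noteq> 0"
    using \<open>w + 1 \<noteq> 0\<close> by simp
  then have "w^2 \<noteq> 1"
    by (simp only: add_eq_0_char2[OF ch] not_False_eq_True)
  ultimately show "w^4 * (1 + w) \<noteq> 1"
    by simp
qed

lemma card_fixed_power_8_char2:
  fixes z :: "'a::finite_field"
  assumes ch: "CHAR('a) = 2" and z: "z^3 = z + 1"
  shows "card {w::'a. w ^ 8 = w} = 8"
proof -
  let ?C = "{w::'a. w^3 = w + 1}" and ?D = "{w::'a. w^3 = w^2 + 1}"
  have "{w::'a. w ^ 8 = w} = {0, 1} \<union> (?C \<union> ?D)"
    by (auto simp: power_8_eq_self_iff_char2[OF ch])
  moreover have "{0, 1} \<inter> (?C \<union> ?D) = {}"
    by (auto simp: numeral_char2[OF ch])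
  moreover have "?C \<inter> ?D = {}"
    using cubic_powers_char2(4)[OF ch] dual_cubic_powers_char2(4)[OF ch] by auto
  ultimately show ?thesis
    by (simp add: card_Un_disjoint roots_cubic_char2(2)[OF ch z] card_dual_cubic_char2[OF ch z])
qed

section \<open>Counting the solutions in a Moebius coordinate\<close>

text \<open>The third root is \<open>r + s\<close>, as the cubic has no quadratic term. In the
  application \<open>2 ^ j\<close> is \<open>q ^ l\<close>. How the power map permutes the roots is
  left open, so that both cases share this setting.\<close>

locale cubic_roots =
  fixes r s a :: "'a::finite_field" and j :: nat
  assumes char2: "CHAR('a) = 2" and a_nz: "a \<noteq> 0" and r_neq_s: "r \<noteq> s"
    and root_r: "r^3 + r = a" and root_s: "s^3 + s = a"
    and frob_cubed: "\<And>x::'a. x ^ (2 ^ (3 * j)) = x"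
begin

abbreviation frob :: "'a \<Rightarrow> 'a" where "frob x \<equiv> x ^ (2 ^ j)"

text \<open>The Moebius coordinate that sends the fixed points \<open>r\<close>, \<open>s\<close>, \<open>r + s\<close> of
  \<open>y \<mapsto> a / (y + 1)\<^sup>2\<close> to \<open>0\<close>, \<open>\<infinity>\<close>, \<open>1\<close>, and thereby turns that map into squaring.
  At its pole \<open>s\<close> it has the junk value \<open>0\<close>.\<close>

definition mob :: "'a \<Rightarrow> 'a" where "mob x = r * (x + r) / (s * (x + s))"

abbreviation sol :: "'a \<Rightarrow> bool" where "sol x \<equiv> x * (frob x)^2 + x + a = 0"

lemma eq0_iff: "x + y = 0 \<longleftrightarrow> x = (y::'a)"
  by (rule add_eq_0_char2[OF char2])

lemma double_eq_0: "x + x = (0::'a)"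
  by (simp only: eq0_iff)

lemma nonzero: "r \<noteq> 0" "s \<noteq> 0" "r + s \<noteq> 0"
proof -
  show "r \<noteq> 0" using root_r a_nz by auto
  show "s \<noteq> 0" using root_s a_nz by auto
  show "r + s \<noteq> 0" using r_neq_s by (simp only: eq0_iff not_False_eq_True)
qed

text \<open>Add the two cubic equations and cancel \<open>r + s\<close>. With
  \<open>product_roots\<close> this gives Vieta's relations for \<open>r\<close>, \<open>s\<close>,
  \<open>r + s\<close>.\<close>

lemma quadratic: "r^2 + r * s + s^2 = 1"
proof -
  have "(r + s) * ((r^2 + r * s + s^2) + 1) = (r^3 + r) + (s^3 + s)"
    by (simp add: char2_expand numeral_char2[OF char2])
  also have "\<dots> = 0"
    by (simp only: root_r root_s double_eq_0)
  finally have "(r^2 + r * s + s^2) + 1 = 0"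
    using nonzero(3) by simp
  then show ?thesis
    by (simp only: eq0_iff)
qed

lemma product_roots: "r * s * (r + s) = a"
proof -
  have "r * s * (r + s) = r * (r^2 + r * s + s^2) + r^3"
    by (simp add: char2_expand numeral_char2[OF char2])
  also have "\<dots> = a"
    using root_r by (simp only: quadratic mult_1_right add.commute[of r "r^3"])
  finally show ?thesis .
qed

lemma third_root: "(r + s)^3 + (r + s) = a"
proof -
  have "(r + s)^3 + (r + s) = (r^3 + r) + ((s^3 + s) + r * s * (r + s))"
    by (simp add: char2_expand numeral_char2[OF char2])
  also have "\<dots> = a"
    by (simp only: root_r root_s product_roots double_eq_0 add_0_right)
  finally show ?thesis .
qed

lemma frob_add: "frob (x + y) = frob x + frob y"
  by (rule frobenius_add[OF char2])

lemma frob_inj: "frob x = frob y \<longleftrightarrow> x = y"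
proof
  assume eq: "frob x = frob y"
  have *: "z ^ (2 ^ (3 * j)) = frob (frob (frob z))" for z :: 'a
    by (simp add: numeral_3_eq_3 power_add mult.assoc flip: power_mult)
  show "x = y"
    using eq frob_cubed[of x] frob_cubed[of y] by (simp only: *)
qed simp

text \<open>The exponent \<open>2 ^ Suc j\<close> means \<open>frob\<close> followed by squaring.
  Three rounds amount to the eighth power, since \<open>frob\<close> has trivial cube.\<close>

lemma frob_power8:
  assumes "((w ^ (2 ^ Suc j)) ^ (2 ^ Suc j)) ^ (2 ^ Suc j) = w"
  shows "w ^ 8 = (w::'a)"
proof -
  have "w ^ 8 = (w ^ (2 ^ (3 * j))) ^ 8"
    by (simp only: frob_cubed)
  also have "\<dots> = w ^ (2 ^ (3 * j) * 2 ^ 3)"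
    by (simp add: power_mult)
  also have "(2::nat) ^ (3 * j) * 2 ^ 3 = 2 ^ Suc j * 2 ^ Suc j * 2 ^ Suc j"
    by (simp add: numeral_3_eq_3 power_add)
  also have "w ^ (2 ^ Suc j * 2 ^ Suc j * 2 ^ Suc j) = w"
    by (simp only: power_mult assms)
  finally show ?thesis .
qed

lemma frob_square: "(frob w)^2 = w ^ (2 ^ Suc j)"
  by (simp flip: power_mult add: mult.commute)

text \<open>The pole \<open>s\<close> is removed on the left; on the right \<open>r / s\<close> is
  removed, the value at infinity.\<close>

lemma mob_bij: "bij_betw mob (- {s}) (- {r / s})"
proof (rule bij_betw_imageI)
  show "inj_on mob (- {s})"
  proof (rule inj_onI)
    fix x y assume xy: "x \<in> - {s}" "y \<in> - {s}" "mob x = mob y"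
    then have "x + s \<noteq> 0" "y + s \<noteq> 0"
      by (auto simp: eq0_iff)
    then have "(x + r) * (y + s) = (y + r) * (x + s)"
      using xy(3) nonzero by (simp add: mob_def frac_eq_eq)
    then have "(x + r) * (y + s) + (y + r) * (x + s) = 0"
      by (simp only: eq0_iff)
    also have "(x + r) * (y + s) + (y + r) * (x + s) = (x + y) * (r + s)"
      by (simp add: char2_expand numeral_char2[OF char2])
    finally show "x = y"
      using nonzero by (simp add: eq0_iff)
  qed
  show "mob ` (- {s}) = - {r / s}"
  proof (intro equalityI subsetI)
    fix w assume "w \<in> mob ` (- {s})"
    then obtain x where x: "x \<noteq> s" "w = mob x" by auto
    then have "x + s \<noteq> 0"
      by (auto simp: eq0_iff)
    then have "mob x = r / s \<longleftrightarrow> x + r = x + s"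
      using nonzero by (simp add: mob_def divide_eq_eq)
    then show "w \<in> - {r / s}"
      using x r_neq_s by simp
  next
    fix w assume "w \<in> - {r / s}"
    define d where "d = w * s + r"
    have d: "d \<noteq> 0"
      using \<open>w \<in> - {r / s}\<close> nonzero by (auto simp: d_def eq0_iff)
    \<comment> \<open>This solves \<open>r * (x + r) = w * s * (x + s)\<close> for
      \<open>x\<close>.\<close>
    define x where "x = (r^2 + w * s^2) / d"
    have "x + s = (r^2 + w * s^2 + s * d) / d" "x + r = (r^2 + w * s^2 + r * d) / d"
      using d by (simp_all add: x_def add_divide_distrib)
    moreover have "r^2 + w * s^2 + s * d = r * (r + s)" "r^2 + w * s^2 + r * d = w * s * (r + s)"
      by (simp_all add: d_def char2_expand numeral_char2[OF char2])
    ultimately have xs: "x + s = r * (r + s) / d" and xr: "x + r = w * s * (r + s) / d"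
      by simp_all
    have "x \<noteq> s"
      using xs d nonzero eq0_iff[of x s] by auto
    moreover have *: "r * (w * s * e / d) / (s * (r * e / d)) = w" if "e \<noteq> 0" for e
      using d nonzero(1,2) that by (simp add: field_simps)
    have "mob x = w"
      unfolding mob_def xs xr using d nonzero *[of "r + s"] by simp
    ultimately show "w \<in> mob ` (- {s})"
      by auto
  qed
qed

lemma mob_square_iff:
  assumes "x \<noteq> s" "y \<noteq> s"
  shows "mob x = (mob y)^2 \<longleftrightarrow> x * y^2 + x + a = 0"
proof -
  have nz: "s * (x + s) \<noteq> 0" "s * (y + s) \<noteq> 0"
    using assms nonzero by (auto simp: eq0_iff)
  have "mob x = (mob y)^2 \<longleftrightarrow> r * (x + r) * (s * (y + s))^2 = s * (x + s) * (r * (y + r))^2"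
    using nz by (simp add: mob_def power_divide frac_eq_eq mult.commute)
  also have "\<dots> \<longleftrightarrow> r * (x + r) * (s * (y + s))^2 + s * (x + s) * (r * (y + r))^2 = 0"
    by (simp only: eq0_iff)
  also have "\<dots> \<longleftrightarrow> a * (x * (y^2 + 1) + a) = 0"
    by (simp only: mobius_identity[OF char2] quadratic product_roots)
  also have "\<dots> \<longleftrightarrow> x * y^2 + x + a = 0"
    using a_nz by (simp only: mult_eq_0_iff) (simp add: distrib_left)
  finally show ?thesis .
qed

text \<open>The coefficients of \<open>mob\<close> are fixed, so \<open>mob\<close> commutes with
  \<open>frob\<close>, and off the pole the equation becomes \<open>w = w ^ (2 ^ Suc j)\<close>. Its
  solutions are all eight elements with \<open>w ^ 8 = w\<close>, or only 0 and 1. The pole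
  \<open>s\<close> is one further solution.\<close>

lemma card_sol_split:
  assumes fix_r: "frob r = r" and fix_s: "frob s = s" and z: "(z::'a)^3 = z + 1"
  shows "card {x. sol x} = (if Suc j mod 3 = 0 then 9 else 3)"
proof -
  have frob_mob: "frob (mob x) = mob (frob x)" for x
    by (simp add: mob_def power_divide power_mult_distrib frob_add fix_r fix_s)
  have s_sol: "sol s"
  proof -
    have "s * s^2 = s^3"
      by (simp add: power3_eq_cube power2_eq_square mult.assoc)
    then show ?thesis
      by (simp only: fix_s root_s double_eq_0)
  qed
  have *: "sol x \<longleftrightarrow> mob x = (frob (mob x))^2" if "x \<noteq> s" for x
    using that mob_square_iff[of x "frob x"] frob_inj[of x s] by (simp add: frob_mob fix_s)
  let ?V = "{w::'a. w ^ (2 ^ Suc j) = w}"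
  \<comment> \<open>The value missed by \<open>mob\<close> must not be counted; since
    \<open>frob\<close> fixes it, it would have to be 0 or 1.\<close>
  have rs: "r / s \<notin> ?V"
  proof
    assume "r / s \<in> ?V"
    then have "(frob (r / s))^2 = r / s"
      by (simp only: frob_square mem_Collect_eq)
    then have "(r / s)^2 = r / s"
      by (simp only: power_divide fix_r fix_s)
    then have "r / s = 0 \<or> r / s = 1"
      by (simp only: power2_eq_square mult_cancel_left2 mult_cancel_right2)
    then show False
      using nonzero r_neq_s by simp
  qed
  have "bij_betw mob {x \<in> - {s}. sol x} {w \<in> - {r / s}. w = (frob w)^2}"
    by (rule bij_betw_Collect[OF mob_bij]) (use * in auto)
  then have "card {x \<in> - {s}. sol x} = card {w \<in> - {r / s}. w = (frob w)^2}"
    by (rule bij_betw_same_card)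
  also have "{w \<in> - {r / s}. w = (frob w)^2} = ?V"
    using rs by (auto simp: frob_square)
  finally have card: "card {x \<in> - {s}. sol x} = card ?V" .
  have "{x. sol x} = insert s {x \<in> - {s}. sol x}"
    using s_sol by auto
  then have total: "card {x. sol x} = Suc (card ?V)"
    by (simp only: flip: card) (simp add: card_insert_disjoint)
  have p8: "w ^ 8 = w" if "w \<in> ?V" for w
    using that by (intro frob_power8) simp
  consider "Suc j mod 3 = 0" | "Suc j mod 3 = 1" | "Suc j mod 3 = 2"
    by linarith
  then show ?thesis
  proof cases
    case 1
    have "?V = {w. w ^ 8 = w}"
      using p8 power_2_power_mod_3[of _ "Suc j"] 1 by auto
    then show ?thesis
      using 1 total card_fixed_power_8_char2[OF char2 z] by simp
  next
    case 2
    have "w ^ (2 ^ Suc j) = w \<longleftrightarrow> w = 0 \<or> w = 1" for w :: 'a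
    proof
      assume w: "w ^ (2 ^ Suc j) = w"
      then have "w^2 = w"
        using p8[of w] power_2_power_mod_3[of w "Suc j"] 2 by simp
      then show "w = 0 \<or> w = 1"
        by (simp add: power2_eq_square)
    qed auto
    then have "?V = {0, 1}"
      by blast
    then show ?thesis
      using 2 total by simp
  next
    case 3
    have "w ^ (2 ^ Suc j) = w \<longleftrightarrow> w = 0 \<or> w = 1" for w :: 'a
    proof
      assume w: "w ^ (2 ^ Suc j) = w"
      then have w8: "w ^ 8 = w" and w4: "w^4 = w"
        using p8[of w] power_2_power_mod_3[of w "Suc j"] 3 by simp_all
      have "w ^ 8 = (w^4)^2"
        by (simp flip: power_mult)
      then have "w^2 = w"
        by (simp only: w8 w4)
      then show "w = 0 \<or> w = 1"
        by (simp add: power2_eq_square)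
    qed auto
    then have "?V = {0, 1}"
      by blast
    then show ?thesis
      using 3 total by simp
  qed
qed

text \<open>Applying \<open>frob\<close> to \<open>mob x\<close> shifts the roots cyclically, and
  the shifted coordinate is \<open>1 / (mob + 1)\<close> at \<open>frob x\<close>. Substituting this
  into \<open>mob x = (mob (frob x))^2\<close> gives the equation for
  \<open>w = mob x\<close>.\<close>

lemma card_sol_cyclic:
  assumes rs: "frob r = s" and st: "frob s = r + s" and z: "(z::'a)^3 = z + 1"
  shows "card {x. sol x} = (if Suc j mod 3 = 0 then 0 else 3)"
proof -
  have tr: "frob (r + s) = r"
    by (simp add: frob_add rs st add.commute[of s] add.assoc double_eq_0)
  have not_sol_s: "\<not> sol s" and not_sol_r: "\<not> sol r"
  proof -
    have "s * (frob s)^2 + s + a = s * ((r + s)^2 + s^2) + (s^3 + s + a)"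
      by (simp add: st char2_expand numeral_char2[OF char2])
    also have "\<dots> = s * r^2"
      by (simp only: root_s double_eq_0) (simp add: char2_expand numeral_char2[OF char2])
    finally show "\<not> sol s"
      using nonzero by simp
    have "r * (frob r)^2 + r + a = r * (s^2 + r^2) + (r^3 + r + a)"
      by (simp add: rs char2_expand numeral_char2[OF char2])
    also have "\<dots> = r * (r + s)^2"
      by (simp only: root_r double_eq_0) (simp add: char2_expand numeral_char2[OF char2])
    finally show "\<not> sol r"
      using nonzero by simp
  qed
  have *: "sol x \<longleftrightarrow> (frob (mob x))^2 * (1 + mob x) = 1" if xs: "x \<noteq> s" for x
  \<comment> \<open>For \<open>x = r\<close> the value \<open>frob x\<close> is the pole
    \<open>s\<close>, so this case is treated apart; both sides are then false.\<close>
  proof (cases "x = r")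
    case True
    then have "mob x = 0"
      by (simp add: mob_def double_eq_0)
    then show ?thesis
      using not_sol_r True by (simp add: power_0_left)
  next
    case False
    define y where "y = frob x"
    have ys: "y \<noteq> s" and yt: "y \<noteq> r + s"
      using frob_inj[of x r] frob_inj[of x s] False xs by (simp_all add: y_def rs st)
    have nz: "y + s \<noteq> 0" "y + (r + s) \<noteq> 0"
      using ys yt by (auto simp: eq0_iff)
    have fm: "frob (mob x) = s * (y + s) / ((r + s) * (y + (r + s)))"
      by (simp add: mob_def power_divide power_mult_distrib frob_add rs st y_def)
    have "(r + s) * (y + (r + s)) = r * (y + r) + s * (y + s)"
      by (simp add: char2_expand numeral_char2[OF char2])
    then have quot: "(r + s) * (y + (r + s)) / (s * (y + s)) = mob y + 1"
      using nz nonzero by (simp add: mob_def add_divide_distrib)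
    have inv: "frob (mob x) = inverse (mob y + 1)"
      by (simp only: fm inverse_divide flip: quot)
    have fnz: "frob (mob x) \<noteq> 0"
      using nz nonzero by (simp add: fm)
    have *: "u = (inverse f)^2 \<longleftrightarrow> f^2 * u = 1" if "f \<noteq> 0" for u f :: 'a
      using that by (auto simp: field_simps)
    have "sol x \<longleftrightarrow> mob x = (mob y)^2"
      using mob_square_iff[OF xs ys] by (simp add: y_def)
    also have "\<dots> \<longleftrightarrow> mob x + (mob y)^2 = 0"
      by (simp only: eq0_iff)
    also have "mob x + (mob y)^2 = (1 + mob x) + (mob y + 1)^2"
      by (simp add: char2_expand numeral_char2[OF char2])
    also have "\<dots> = 0 \<longleftrightarrow> 1 + mob x = (inverse (frob (mob x)))^2"
      by (simp only: eq0_iff inv inverse_inverse_eq)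
    also have "\<dots> \<longleftrightarrow> (frob (mob x))^2 * (1 + mob x) = 1"
      by (rule *[OF fnz])
    finally show ?thesis .
  qed
  let ?V = "{w::'a. w ^ (2 ^ Suc j) * (1 + w) = 1}"
  have notV: "r / s \<notin> ?V"
  proof
    assume "r / s \<in> ?V"
    then have "(frob (r / s))^2 * (1 + r / s) = 1"
      by (simp only: frob_square mem_Collect_eq)
    then have "(s / (r + s))^2 * (1 + r / s) = 1"
      by (simp only: power_divide rs st)
    moreover have "1 + r / s = (r + s) / s"
      using nonzero by (simp add: field_simps)
    ultimately have "s / (r + s) = 1"
      using nonzero by (simp add: power2_eq_square)
    then have "s = r + s"
      using nonzero by (simp only: divide_eq_1_iff)
    then show False
      using nonzero by simp
  qed
  have "bij_betw mob {x \<in> - {s}. sol x} {w \<in> - {r / s}. (frob w)^2 * (1 + w) = 1}"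
    by (rule bij_betw_Collect[OF mob_bij]) (use * in auto)
  then have "card {x \<in> - {s}. sol x} = card {w \<in> - {r / s}. (frob w)^2 * (1 + w) = 1}"
    by (rule bij_betw_same_card)
  also have "{w \<in> - {r / s}. (frob w)^2 * (1 + w) = 1} = ?V"
    using notV by (auto simp: frob_square)
  also have "{x \<in> - {s}. sol x} = {x. sol x}"
    using not_sol_s by auto
  finally have card: "card {x. sol x} = card ?V" .
  have p8: "w ^ 8 = w \<and> w \<noteq> 0 \<and> w \<noteq> 1" if "w \<in> ?V" for w
  proof (intro conjI)
    from that have w: "w ^ (2 ^ Suc j) * (1 + w) = 1" by simp
    show w0: "w \<noteq> 0" and w1: "w \<noteq> 1"
      using w by (auto simp: power_0_left numeral_char2[OF char2])
    then have nz: "1 + w \<noteq> 0"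
      by (auto simp: eq0_iff)
    \<comment> \<open>The equation says \<open>f w = 1 / (1 + w)\<close>. This Moebius map has order
      three and coefficients fixed by the field endomorphism \<open>f\<close>, so
      \<open>f (f (f w)) = w\<close>.\<close>
    define f where "f v = v ^ (2 ^ Suc j)" for v :: 'a
    have f_add: "f (u + v) = f u + f v" for u v
      unfolding f_def by (rule frobenius_add[OF char2])
    have f_mult: "f (u * v) = f u * f v" for u v
      unfolding f_def by (rule power_mult_distrib)
    have f_inv: "f (inverse u) = inverse (f u)" for u
      unfolding f_def by (rule power_inverse)
    have f1: "f 1 = 1"
      by (simp add: f_def)
    have fw: "f w = inverse (1 + w)"
      using w inverse_unique[of "1 + w" "f w"] by (simp add: f_def mult.commute)
    have "1 + f w = inverse (1 + w) * ((1 + w) + 1)"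
      unfolding fw by (simp only: distrib_left[of _ "1 + w" 1] left_inverse[OF nz] mult_1_right)
    also have "(1 + w) + 1 = w"
      by (simp add: numeral_char2[OF char2])
    finally have f2: "f (f w) = (1 + w) * inverse w"
      by (subst fw) (simp add: f_inv f_add f1)
    have "f (f (f w)) = (1 + f w) * inverse (f w)"
      by (simp only: f2 f_mult f_inv f_add f1)
    also have "\<dots> = w"
      using \<open>1 + f w = inverse (1 + w) * ((1 + w) + 1)\<close> \<open>(1 + w) + 1 = w\<close> nz
      by (simp add: fw)
    finally show "w ^ 8 = w"
      by (intro frob_power8) (simp only: f_def)
  qed
  have mem: "w \<in> ?V \<longleftrightarrow> (w^3 = w + 1 \<or> w^3 = w^2 + 1) \<and> w ^ (2 ^ (Suc j mod 3)) * (1 + w) = 1" for w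
  proof
    assume w: "w \<in> ?V"
    then show "(w^3 = w + 1 \<or> w^3 = w^2 + 1) \<and> w ^ (2 ^ (Suc j mod 3)) * (1 + w) = 1"
      using p8[OF w] power_8_eq_self_iff_char2[OF char2, of w] power_2_power_mod_3[of w "Suc j"] by auto
  next
    assume w: "(w^3 = w + 1 \<or> w^3 = w^2 + 1) \<and> w ^ (2 ^ (Suc j mod 3)) * (1 + w) = 1"
    then have "w ^ 8 = w"
      using power_8_eq_self_iff_char2[OF char2, of w] by blast
    then show "w \<in> ?V"
      using w power_2_power_mod_3[of w "Suc j"] by auto
  qed
  \<comment> \<open>The exponents 1, 2, 4 select neither cubic, \<open>w^3 = w^2 + 1\<close> and
    \<open>w^3 = w + 1\<close>, respectively.\<close>
  note C = cubic_powers_char2[OF char2] and D = dual_cubic_powers_char2[OF char2]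
  consider "Suc j mod 3 = 0" | "Suc j mod 3 = 1" | "Suc j mod 3 = 2"
    by linarith
  then show ?thesis
  proof cases
    case 1
    have "?V = {}"
      using mem C(3) D(3) by (auto simp only: 1 power_0 power_one_right empty_iff)
    then show ?thesis
      using 1 card by simp
  next
    case 2
    have "w \<in> ?V \<longleftrightarrow> w^3 = w^2 + 1" for w
      using mem[of w] C(4)[of w] D(4)[of w] unfolding 2 power_one_right by blast
    then have "?V = {w. w^3 = w^2 + 1}"
      by blast
    then show ?thesis
      using 2 card card_dual_cubic_char2[OF char2 z] by simp
  next
    case 3
    have two: "(2::nat)^2 = 4" by simp
    have "w \<in> ?V \<longleftrightarrow> w^3 = w + 1" for w
      using mem[of w, unfolded 3 two] C(5)[of w] D(5)[of w] by blast
    then have "?V = {w. w^3 = w + 1}"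
      by blast
    then show ?thesis
      using 3 card roots_cubic_char2(2)[OF char2 z] by simp
  qed
qed

end

section \<open>Descent from the algebraic closure\<close>

text \<open>With \<open>N\<close> the size of the field, \<open>X^N - X\<close> has at most
  \<open>N\<close> roots, and the \<open>N\<close> embedded elements already are roots.\<close>

lemma power_card_eq_imp_range_to_ac:
  fixes y :: "'a::finite_field alg_closure"
  assumes "y ^ card (UNIV :: 'a set) = y"
  shows "y \<in> range to_ac"
proof -
  define N where "N = card (UNIV :: 'a set)"
  define p :: "'a alg_closure poly" where "p = Polynomial.monom 1 N - Polynomial.monom 1 1"
  have "card {0, 1 :: 'a} \<le> N"
    unfolding N_def by (rule card_mono) simp_all
  then have N: "N \<noteq> 1" "N > 1"
    by simp_all
  then have "Polynomial.coeff p N = 1"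
    by (simp add: p_def)
  then have "p \<noteq> 0"
    by auto
  have "degree p \<le> N"
    unfolding p_def using N by (intro degree_diff_le) (simp_all add: degree_monom_eq)
  let ?Z = "{x. poly p x = 0}"
  have "finite ?Z"
    by (rule poly_roots_finite) fact
  have "card ?Z \<le> N"
    using card_poly_roots_bound[OF \<open>p \<noteq> 0\<close>] \<open>degree p \<le> N\<close> by linarith
  have "range to_ac \<subseteq> ?Z"
    using finite_field_power_card_eq_same[where 'a = 'a]
    by (auto simp: p_def poly_monom N_def simp flip: to_ac_power)
  moreover have "card (range (to_ac :: 'a \<Rightarrow> _)) = N"
    by (simp add: card_image inj_to_ac N_def)
  ultimately have "range to_ac = ?Z"
    using \<open>finite ?Z\<close> \<open>card ?Z \<le> N\<close> by (metis card_seteq)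
  moreover have "y \<in> ?Z"
    using assms by (simp add: p_def poly_monom N_def)
  ultimately show ?thesis
    by blast
qed

lemma alg_closed_quadratic_root:
  fixes b c :: "'a::alg_closed_field"
  shows "\<exists>x. x^2 + b * x + c = 0"
  using alg_closed[of 2 "\<lambda>k. if k = 0 then c else if k = 1 then b else 1"]
  by (auto simp: numeral_2_eq_2 algebra_simps)

text \<open>A root in the closure satisfies \<open>z ^ 8 = z\<close>, hence is fixed by the power
  map with exponent \<open>2 ^ (3 * m)\<close> and lies in the finite field.\<close>

lemma exists_cubic_root_finite_field:
  assumes ch: "CHAR('a::finite_field) = 2" and card: "card (UNIV :: 'a set) = 2 ^ (3 * m)"
  shows "\<exists>z::'a. z^3 = z + 1"
proof -
  have ch': "CHAR('a alg_closure) = 2"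
    by (simp add: ch)
  obtain z :: "'a alg_closure" where "(\<Sum>k\<le>3. (if k = 2 then 0 else 1) * z ^ k) = 0"
    using alg_closed[of 3 "\<lambda>k. if k = 2 then 0 else 1 :: 'a alg_closure"] by auto
  then have "z^3 + (z + 1) = 0"
    by (simp add: numeral_2_eq_2 numeral_3_eq_3 algebra_simps)
  then have z: "z^3 = z + 1"
    by (simp only: add_eq_0_char2[OF ch'])
  then have "z ^ 8 = z"
    by (simp add: power_8_eq_self_iff_char2[OF ch'])
  then have "z ^ (2 ^ (3 * m)) = z"
    using power_2_power_mod_3[of z "3 * m"] by simp
  then obtain u where "z = to_ac u"
    using power_card_eq_imp_range_to_ac[of z] card by auto
  then have "to_ac (u^3) = to_ac (u + 1)"
    using z by simp
  then show ?thesis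
    by (subst (asm) to_ac_eq_iff) blast
qed

section \<open>Dickson polynomials\<close>

lemma dickson_poly_rat_eval:
  "rat_eval (dickson_poly n) (ratX + inverse ratX) = ratX ^ n + inverse ratX ^ n"
  unfolding dickson_poly_def by (rule theI') (rule dickson_poly_ex1)

lemma dickson_poly_eqI:
  assumes "rat_eval D (ratX + inverse ratX) = ratX ^ n + inverse ratX ^ n"
  shows "dickson_poly n = D"
  unfolding dickson_poly_def using dickson_poly_ex1 assms by (rule the1_equality)

lemma dickson_poly_0: "dickson_poly 0 = 0"
proof (rule dickson_poly_eqI)
  have "(1 + 1 :: bit poly fract) = to_fract (1 + 1)"
    by (simp only: to_fract_add to_fract_1)
  also have "1 + 1 = (0 :: bit poly)"
    by (simp add: one_pCons)
  finally show "rat_eval 0 (ratX + inverse ratX) = ratX ^ 0 + inverse ratX ^ 0"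
    by (simp add: rat_eval_0)
qed

lemma dickson_poly_1: "dickson_poly (Suc 0) = [:0, 1:]"
  by (rule dickson_poly_eqI) (simp add: rat_eval_pCons[of 0] rat_eval_1)

lemma dickson_poly_Suc_Suc:
  "dickson_poly (Suc (Suc n)) = pCons 0 (dickson_poly (Suc n)) - dickson_poly n"
proof (rule dickson_poly_eqI)
  have "rat_eval (pCons 0 (dickson_poly (Suc n)) - dickson_poly n) (ratX + inverse ratX) =
      (ratX + inverse ratX) * (ratX ^ Suc n + inverse ratX ^ Suc n) - (ratX ^ n + inverse ratX ^ n)"
    by (simp add: rat_eval_diff rat_eval_pCons dickson_poly_rat_eval)
  also have "\<dots> = ratX ^ Suc (Suc n) + inverse ratX ^ Suc (Suc n)"
    using ratX_nonzero by (simp add: field_simps)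
  finally show "rat_eval (pCons 0 (dickson_poly (Suc n)) - dickson_poly n) (ratX + inverse ratX) =
      ratX ^ Suc (Suc n) + inverse ratX ^ Suc (Suc n)" .
qed

lemma poly_of_bit_pCons:
  "poly (map_poly of_bit (pCons c p)) x = of_bit c + x * poly (map_poly of_bit p) (x::'a::comm_ring_1)"
  by (simp add: map_poly_pCons)

text \<open>The difference 0 - 1 is 1 among bits and -1 in the target; characteristic two makes them
  agree.\<close>

lemma poly_of_bit_diff:
  assumes "CHAR('a::comm_ring_1) = 2"
  shows "poly (map_poly of_bit (p - p')) (x::'a) = poly (map_poly of_bit p) x - poly (map_poly of_bit p') x"
proof -
  have "of_bit (b - c) = (of_bit b - of_bit c :: 'a)" for b c :: bit
    by (cases b; cases c) (simp_all add: uminus_CHAR_2[OF assms])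
  then have "map_poly of_bit (p - p') = map_poly of_bit p - (map_poly of_bit p' :: 'a poly)"
    by (intro poly_eqI) (simp add: coeff_map_poly)
  then show ?thesis
    by simp
qed

text \<open>The defining identity lives in the rational function field; the recurrence carries it
  over to a nonzero element \<open>t\<close>.\<close>

lemma poly_dickson_poly:
  fixes t :: "'a::field"
  assumes ch: "CHAR('a) = 2" and "t \<noteq> 0"
  shows "poly (map_poly of_bit (dickson_poly n)) (t + inverse t) = t ^ n + inverse t ^ n"
proof (induction n rule: induct_nat_012)
  case 0
  show ?case
    by (simp add: dickson_poly_0 numeral_char2[OF ch])
next
  case 1
  show ?case
    by (simp add: dickson_poly_1 map_poly_pCons)
next
  case (ge2 n)
  show ?case
    unfolding dickson_poly_Suc_Suc poly_of_bit_diff[OF ch] poly_of_bit_pCons ge2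
    using \<open>t \<noteq> 0\<close> by (simp add: field_simps)
qed

lemma poly_of_bit_to_ac:
  "poly (map_poly of_bit p) (to_ac x) = to_ac (poly (map_poly of_bit p) (x::'a::field))"
  by (induction p) (simp_all add: map_poly_pCons)

section \<open>The Frobenius action on the roots of the cubic\<close>

text \<open>For a root of an Artin-Schreier equation, each further squaring adds one more conjugate
  of \<open>c\<close>.\<close>

lemma trace2_power_eq:
  assumes ch: "CHAR('a::field) = 2" and "y^2 = y + (c::'a)"
  shows "y ^ (2 ^ k) = y + trace2 k c"
proof (induction k)
  case (Suc k)
  have "y ^ (2 ^ Suc k) = (y^2) ^ (2 ^ k)"
    by (simp flip: power_mult)
  also have "\<dots> = y ^ (2 ^ k) + c ^ (2 ^ k)"
    by (simp only: assms(2) frobenius_add[OF ch])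
  finally show ?case
    by (simp add: Suc trace2_def add.assoc)
qed (simp add: trace2_def)

lemma trace2_square:
  assumes "CHAR('a::field) = 2"
  shows "trace2 m (c^2 :: 'a) = (trace2 m c)^2"
  unfolding trace2_def
  by (subst freshmans_dream_sum[of 2]) (simp_all add: assms mult.commute flip: power_mult)

lemma trace2_1: "trace2 m (1 :: 'a::field) = of_nat m"
  by (simp add: trace2_def)

lemma of_nat_char2:
  assumes "CHAR('a::comm_ring_1) = 2"
  shows "(of_nat m :: 'a) = of_bool (odd m)"
  using assms by (cases "even m") (auto elim!: evenE oddE simp: numeral_char2[OF assms])

lemma add_inverse_eq_iff:
  fixes x y :: "'a::field"
  assumes "x \<noteq> 0" "y \<noteq> 0"
  shows "x + inverse x = y + inverse y \<longleftrightarrow> x = y \<or> x * y = 1"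
proof -
  have "x * y * ((x + inverse x) - (y + inverse y)) = (x - y) * (x * y - 1)"
    using assms by (simp add: field_simps)
  then show ?thesis
    using assms by (metis eq_iff_diff_eq_0 mult_eq_0_iff)
qed

text \<open>The second alternative fixes the order of the roots: the \<open>q\<close>-power map
  sends \<open>r\<close> to \<open>s\<close> and \<open>s\<close> to the third root.\<close>

lemma cubic_roots_frobenius:
  fixes a :: "'a::alg_closed_field"
  assumes ch: "CHAR('a) = 2" and a: "a \<noteq> 0" and q: "q = 2 ^ m" and aq: "a ^ q = a"
    and tr: "trace2 m (1 / a) = trace2 m 1" and n: "n = (q + 1) div 3"
  obtains r s where "r \<noteq> s" "r^3 + r = a" "s^3 + s = a"
    "if poly (map_poly of_bit (dickson_poly n)) a = 0 then r ^ q = r \<and> s ^ q = s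
      else r ^ q = s \<and> s ^ q = r + s"
proof -
  note eq0 = add_eq_0_char2[OF ch]
  define rho where "rho x = x + inverse x" for x :: 'a
  obtain t where t: "t^2 + a * t + 1 = 0"
    using alg_closed_quadratic_root by blast
  have t0: "t \<noteq> 0"
    using t by auto
  have at: "a = t + inverse t"
  proof -
    have "(t^2 + a * t + 1) * inverse t = t + inverse t + a"
      using t0 by (simp add: field_simps power2_eq_square)
    then have "t + inverse t + a = 0"
      by (simp add: t)
    then show ?thesis
      by (simp only: eq0)
  qed
  have t_sq: "t^2 \<noteq> 1"
  proof
    assume "t^2 = 1"
    then have "inverse t = t"
      using t0 by (simp add: field_simps power2_eq_square)
    then show False
      using a by (simp add: at numeral_char2[OF ch])
  qed
  \<comment> \<open>The quotient \<open>t / a\<close> solves the Artin-Schreier equation with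
    constant \<open>(1 / a)^2\<close>, whose trace is that of 1. So \<open>t ^ q\<close> is
    \<open>t\<close> or \<open>t + a = inverse t\<close>.\<close>
  have tq: "t ^ q = (if even m then t else inverse t)"
  proof -
    have "(t / a)^2 + (t / a + (1 / a)^2) = (t^2 + a * t + 1) / a^2"
      using a by (simp add: field_simps power2_eq_square)
    then have "(t / a)^2 + (t / a + (1 / a)^2) = 0"
      by (simp add: t)
    then have "(t / a)^2 = t / a + (1 / a)^2"
      by (simp only: eq0)
    then have "(t / a) ^ q = t / a + trace2 m ((1 / a)^2)"
      unfolding q by (rule trace2_power_eq[OF ch])
    also have "trace2 m ((1 / a)^2) = of_bool (odd m)"
      by (simp only: trace2_square[OF ch] tr trace2_1 of_nat_char2[OF ch]) simp
    finally have "t ^ q / a = t / a + of_bool (odd m)"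
      by (simp only: power_divide aq)
    then have *: "t ^ q = t + a * of_bool (odd m)"
      using a by (simp add: field_simps)
    have "t + (t + inverse t) = inverse t"
      by (simp add: numeral_char2[OF ch] flip: add.assoc)
    then show ?thesis
      by (simp add: *) (simp add: at)
  qed
  \<comment> \<open>Powers of 2 alternate between 1 and 2 modulo 3. The fact \<open>n0\<close> makes
    the truncated subtraction exact.\<close>
  have q3: "q = (if even m then 3 * n + 1 else 3 * n - 1)" and n0: "n > 0 \<or> even m"
  proof -
    have "(2::nat) ^ m mod 3 = (if even m then 1 else 2)"
    proof (induction m)
      case (Suc m)
      have "2 * x mod 3 = (if P then 2 else 1)" if "x mod 3 = (if P then 1 else 2)" for x :: nat and P
        using that by (cases P) (simp_all, presburger+)
      from this[OF Suc] show ?case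
        by simp
    qed simp
    then have "q mod 3 = (if even m then 1 else 2)"
      by (simp only: q)
    then show "q = (if even m then 3 * n + 1 else 3 * n - 1)" "n > 0 \<or> even m"
      unfolding n by (cases "even m"; simp; presburger)+
  qed
  have tn3: "(t ^ n)^3 = 1"
  proof (cases "even m")
    case True
    then have "t ^ (3 * n) * t = t"
      using tq q3 by simp
    then show ?thesis
      using t0 by (simp add: mult.commute flip: power_mult)
  next
    case False
    then have "3 * n = Suc q"
      using q3 n0 by simp
    then have "t ^ (3 * n) = 1"
      using tq False t0 by simp
    then show ?thesis
      by (simp add: mult.commute flip: power_mult)
  qed
  obtain w where w: "w^3 = t"
    using nth_root_exists[of 3 t] by auto
  have w0: "w \<noteq> 0"
    using w t0 by auto
  obtain \<omega> :: 'a where "\<omega>^2 + 1 * \<omega> + 1 = 0"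
    using alg_closed_quadratic_root by blast
  then have \<omega>: "\<omega>^2 + \<omega> + 1 = 0" by simp
  have "\<omega>^3 - 1 = (\<omega> - 1) * (\<omega>^2 + \<omega> + 1)"
    by (simp add: algebra_simps power2_eq_square power3_eq_cube)
  then have \<omega>3: "\<omega>^3 = 1"
    by (simp add: \<omega>)
  have \<omega>1: "\<omega> \<noteq> 1"
    using \<omega> by (auto simp: numeral_char2[OF ch])
  have rho_cubic: "rho (u * w)^3 + rho (u * w) = a" if "u^3 = 1" for u
  proof -
    define x where "x = u * w"
    have "x \<noteq> 0" and x3: "x^3 = t"
      using that w0 w by (auto simp: x_def power_mult_distrib)
    \<comment> \<open>Expanding the cube of \<open>x + inverse x\<close> leaves a multiple 3 of
      \<open>rho x\<close>, which cancels the linear term in characteristic two.\<close>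
    have "rho x^3 + rho x = x^3 + inverse x^3 + (1 + x * inverse x) * rho x + 2 * (x * inverse x * rho x)"
      by (simp add: rho_def algebra_simps power3_eq_cube)
    also have "\<dots> = a"
      using \<open>x \<noteq> 0\<close> by (simp add: numeral_char2[OF ch] x3 at power_inverse)
    finally show ?thesis
      by (simp only: x_def)
  qed
  have rho_inj: "u = v" if "u^3 = 1" "v^3 = 1" "rho (u * w) = rho (v * w)" for u v
  proof (rule ccontr)
    assume "u \<noteq> v"
    moreover have "u \<noteq> 0" "v \<noteq> 0"
      using that by auto
    ultimately have "(u * w) * (v * w) = 1"
      using that(3) w0 add_inverse_eq_iff[of "u * w" "v * w"] by (simp add: rho_def)
    then have "((u * w) * (v * w))^3 = 1"
      by simp
    then have "t^2 = 1"
      by (simp add: power_mult_distrib that w power2_eq_square)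
    then show False
      using t_sq by simp
  qed
  \<comment> \<open>For odd \<open>m\<close> the \<open>q\<close>-power map also inverts the
    argument of \<open>rho\<close>. As \<open>rho\<close> is invariant under inversion, the factor
    to record is the inverse of \<open>t ^ n\<close>.\<close>
  define \<kappa> where "\<kappa> = (if even m then t ^ n else inverse (t ^ n))"
  have \<kappa>3: "\<kappa>^3 = 1"
    by (simp add: \<kappa>_def tn3 power_inverse)
  have unit_q: "u ^ q = (if even m then u else inverse u)" if u3: "u^3 = 1" for u :: 'a
  proof (cases "even m")
    case True
    then show ?thesis
      using q3 u3 by (simp add: power_mult)
  next
    case False
    then have "u * u ^ q = u ^ (3 * n)"
      using q3 n0 by (simp flip: power_Suc)
    also have "\<dots> = 1"
      by (simp add: power_mult u3)
    finally show ?thesis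
      using False inverse_unique[of u "u ^ q"] by simp
  qed
  have w_q: "w ^ q = (if even m then t ^ n * w else t ^ n * inverse w)"
  proof (cases "even m")
    case True
    then show ?thesis
      using q3 by (simp add: power_mult w)
  next
    case False
    then have "w * w ^ q = w ^ (3 * n)"
      using q3 n0 by (simp flip: power_Suc)
    also have "\<dots> = t ^ n"
      by (simp add: power_mult w)
    finally show ?thesis
      using False w0 by (simp add: field_simps)
  qed
  have rho_q: "rho (u * w) ^ q = rho (\<kappa> * u * w)" if u3: "u^3 = 1" for u
  proof -
    have "rho (u * w) ^ q = rho ((u * w) ^ q)"
      unfolding rho_def q frobenius_add[OF ch] power_inverse ..
    also have "\<dots> = rho (\<kappa> * u * w)"
      by (simp add: power_mult_distrib unit_q[OF u3] w_q \<kappa>_def rho_def mult_ac add.commute)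
    finally show ?thesis .
  qed
  have "poly (map_poly of_bit (dickson_poly n)) a = t ^ n + inverse (t ^ n)"
    by (simp only: at poly_dickson_poly[OF ch t0] power_inverse)
  also have "\<dots> = 0 \<longleftrightarrow> t ^ n = 1"
  proof -
    have "t ^ n + inverse (t ^ n) = 0 \<longleftrightarrow> t ^ n = inverse (t ^ n)"
      by (rule eq0)
    also have "\<dots> \<longleftrightarrow> (t ^ n)^2 = 1"
      using t0 by (simp add: field_simps power2_eq_square)
    also have "\<dots> \<longleftrightarrow> t ^ n = 1"
      using tn3 by (auto simp: power2_eq_square power3_eq_cube)
    finally show ?thesis .
  qed
  also have "\<dots> \<longleftrightarrow> \<kappa> = 1"
    by (simp add: \<kappa>_def)
  finally have D: "poly (map_poly of_bit (dickson_poly n)) a = 0 \<longleftrightarrow> \<kappa> = 1" .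
  have one3: "(1::'a)^3 = 1" by simp
  show thesis
  proof (cases "\<kappa> = 1")
    case True
    \<comment> \<open>Any primitive cube root of unity yields a second root here. In the other case
      \<open>\<kappa>\<close> itself is taken, so that the second root is the \<open>q\<close>-th
      power of the first.\<close>
    show thesis
    proof (rule that)
      show "rho (1 * w) \<noteq> rho (\<omega> * w)"
        using rho_inj[OF one3 \<omega>3] \<omega>1 by auto
      show "rho (1 * w)^3 + rho (1 * w) = a" "rho (\<omega> * w)^3 + rho (\<omega> * w) = a"
        by (rule rho_cubic, fact)+
      show "if poly (map_poly of_bit (dickson_poly n)) a = 0
        then rho (1 * w) ^ q = rho (1 * w) \<and> rho (\<omega> * w) ^ q = rho (\<omega> * w)
        else rho (1 * w) ^ q = rho (\<omega> * w) \<and> rho (\<omega> * w) ^ q = rho (1 * w) + rho (\<omega> * w)"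
        using rho_q[OF one3] rho_q[OF \<omega>3] D True by simp
    qed
  next
    case False
    have "(\<kappa> - 1) * (\<kappa>^2 + \<kappa> + 1) = \<kappa>^3 - 1"
      by (simp add: algebra_simps power2_eq_square power3_eq_cube)
    then have "\<kappa>^2 + (1 + \<kappa>) = 0"
      using False \<kappa>3 by (simp add: add_ac)
    then have \<kappa>2: "\<kappa>^2 = 1 + \<kappa>"
      by (simp only: eq0)
    have inv: "inverse \<kappa> = \<kappa>^2"
      using \<kappa>3 by (intro inverse_unique) (simp add: power2_eq_square power3_eq_cube mult.assoc)
    have inv2: "inverse (\<kappa>^2) = \<kappa>"
      by (simp flip: inv)
    \<comment> \<open>The relation \<open>1 + \<kappa> + \<kappa>^2 = 0\<close> makes the three
      values of \<open>rho\<close> sum to zero.\<close>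
    have "rho (\<kappa> * \<kappa> * w) = \<kappa>^2 * w + inverse (\<kappa>^2) * inverse w"
      by (simp add: rho_def power2_eq_square)
    also have "\<dots> = w + (\<kappa> * w + \<kappa> * inverse w)"
      unfolding inv2 unfolding \<kappa>2 by (simp add: algebra_simps)
    also have "\<dots> = (w + inverse w) + (\<kappa> * w + \<kappa>^2 * inverse w)"
      by (simp add: \<kappa>2 algebra_simps numeral_char2[OF ch])
    also have "\<dots> = rho (1 * w) + rho (\<kappa> * w)"
      by (simp add: rho_def inv)
    finally have sum: "rho (\<kappa> * \<kappa> * w) = rho (1 * w) + rho (\<kappa> * w)" .
    show thesis
    proof (rule that)
      show "rho (1 * w) \<noteq> rho (\<kappa> * w)"
        using rho_inj[OF one3 \<kappa>3] False by auto
      show "rho (1 * w)^3 + rho (1 * w) = a" "rho (\<kappa> * w)^3 + rho (\<kappa> * w) = a"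
        by (rule rho_cubic, fact)+
      show "if poly (map_poly of_bit (dickson_poly n)) a = 0
        then rho (1 * w) ^ q = rho (1 * w) \<and> rho (\<kappa> * w) ^ q = rho (\<kappa> * w)
        else rho (1 * w) ^ q = rho (\<kappa> * w) \<and> rho (\<kappa> * w) ^ q = rho (1 * w) + rho (\<kappa> * w)"
        using rho_q[OF one3] rho_q[OF \<kappa>3] D False sum by simp
    qed
  qed
qed

section \<open>The number of roots\<close>

text \<open>Fermat's argument: multiplication by a nonzero \<open>x\<close> permutes the nonzero
  elements of \<open>F\<close>, so their product is unchanged. For \<open>x = 0\<close> the exponent
  must be positive, as \<open>0 ^ 0 = 1\<close>.\<close>

lemma subfield_power_card:
  fixes x :: "'a::finite_field"
  assumes sub: "subfield F (ring_of_type_algebra :: 'a ring)" and x: "x \<in> F"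
  shows "x ^ card F = x"
proof (cases "x = 0")
  case True
  then have "card F > 0"
    using x by (auto simp: card_gt_0_iff)
  then show ?thesis
    using True by simp
next
  case False
  interpret subfield F "ring_of_type_algebra :: 'a ring" by fact
  have mult: "u * v \<in> F" if "u \<in> F" "v \<in> F" for u v
    using subringE(6)[OF subring_axioms that] by (simp add: ring_of_type_algebra_def)
  have "0 \<in> F"
    using subringE(2)[OF subring_axioms] by (simp add: ring_of_type_algebra_def)
  let ?G = "F - {0}"
  have inj: "inj_on ((*) x) ?G"
    using False by (simp add: inj_on_def)
  moreover have "(*) x ` ?G \<subseteq> ?G"
    using False x mult by auto
  ultimately have image: "(*) x ` ?G = ?G"
    by (simp add: endo_inj_surj)
  have "\<Prod>?G = \<Prod>((*) x ` ?G)"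
    by (simp only: image)
  also have "\<dots> = (\<Prod>y\<in>?G. x * y)"
    by (simp add: prod.reindex[OF inj])
  also have "\<dots> = x ^ card ?G * \<Prod>?G"
    by (simp add: prod.distrib)
  finally have "x ^ card ?G = 1"
    by simp
  moreover have "card F = Suc (card ?G)"
    using \<open>0 \<in> F\<close> card_Suc_Diff1[of F 0] by simp
  ultimately show ?thesis
    by simp
qed

lemma char_2_finite_field:
  assumes "card (UNIV :: 'a::finite_field set) = 2 ^ k"
  shows "CHAR('a) = 2"
proof -
  have "prime CHAR('a)"
    by (intro prime_CHAR_semidom finite_imp_CHAR_pos finite_class.finite_UNIV)
  moreover have "CHAR('a) dvd 2 ^ k"
    using CHAR_dvd_CARD[where 'a = 'a] by (simp only: assms)
  ultimately have "CHAR('a) dvd 2"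
    by (rule prime_dvd_power)
  then show ?thesis
    using \<open>prime CHAR('a)\<close> primes_dvd_imp_eq two_is_prime_nat by blast
qed

theorem theorem1p1:
  fixes l m q n N :: nat
    and a :: "'a::finite_field"
    and F :: "'a set"
  assumes "l > 0" and "m > 0" and "\<not> 3 dvd l"
    and "q = 2 ^ m" and "n = (q + 1) div 3"
    and "card (UNIV :: 'a set) = q ^ 3"
    and "subfield F (ring_of_type_algebra :: 'a ring)" and "card F = q"
    and "a \<in> F - {0, 1}"
    and "trace2 m (1 / a) = trace2 m 1"
    and "N = card {x :: 'a. poly (Polynomial.monom 1 (2 * q ^ l + 1) + Polynomial.monom 1 1 + [:a:]) x = 0}"
  shows "(\<not> [int l = - int m] (mod 3) \<longrightarrow> N = 3) \<and>
    ([int l = - int m] (mod 3) \<longrightarrow>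
      N \<in> {0, 9} \<and> (N = 9 \<longleftrightarrow> poly (map_poly of_bit (dickson_poly n)) a = 0))"
proof -
  define j where "j = m * l"
  have card: "card (UNIV :: 'a set) = 2 ^ (3 * m)"
    using assms(4,6) by (simp add: mult.commute flip: power_mult)
  have ch: "CHAR('a) = 2"
    using card by (rule char_2_finite_field)
  have a0: "a \<noteq> 0" and aq: "a ^ q = a"
    using assms(7-9) subfield_power_card[of F a] by auto
  have frob_cubed: "x ^ (2 ^ (3 * j)) = x" for x :: 'a
    by (rule finite_field_power_card_power_eq_same[where n = l])
      (simp add: card j_def mult.assoc flip: power_mult)
  have frob: "x ^ (2 ^ j) = x ^ (q ^ l)" for x :: 'a
    by (simp add: j_def assms(4) power_mult)
  obtain z :: 'a where z: "z^3 = z + 1"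
    using exists_cubic_root_finite_field[OF ch card] by blast
  have N: "N = card {x :: 'a. x * (x ^ (2 ^ j))^2 + x + a = 0}"
    unfolding assms(11) frob by (simp add: poly_monom power_even_eq)
  \<comment> \<open>As 3 does not divide \<open>l\<close>, its square is 1 modulo 3, so
    \<open>m * l + 1\<close> is congruent to \<open>l * (m + l)\<close>.\<close>
  have cong: "[int l = - int m] (mod 3) \<longleftrightarrow> Suc j mod 3 = 0"
  proof -
    have "[int l = - int m] (mod 3) \<longleftrightarrow> (l + m) mod 3 = 0"
    proof -
      have "[int l = - int m] (mod 3) \<longleftrightarrow> int 3 dvd int (l + m)"
        by (simp add: cong_iff_dvd_diff)
      then show ?thesis
        by (simp only: int_dvd_int_iff mod_eq_0_iff_dvd)
    qed
    also have "(l + m) mod 3 = (l mod 3 + m mod 3) mod 3"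
      by (simp only: mod_add_eq)
    also have "\<dots> = 0 \<longleftrightarrow> Suc ((m mod 3) * (l mod 3)) mod 3 = 0"
    proof -
      have "l mod 3 = 1 \<or> l mod 3 = 2" "m mod 3 = 0 \<or> m mod 3 = 1 \<or> m mod 3 = 2"
        using assms(3) by presburger+
      then show ?thesis
        by (elim disjE) simp_all
    qed
    also have "Suc ((m mod 3) * (l mod 3)) mod 3 = Suc j mod 3"
      unfolding j_def by (metis mod_Suc_eq mod_mult_eq)
    finally show ?thesis .
  qed
  let ?D = "poly (map_poly of_bit (dickson_poly n)) a"
  have ch': "CHAR('a alg_closure) = 2"
    by (simp add: ch)
  have "trace2 m (1 / to_ac a) = to_ac (trace2 m (1 / a))" "trace2 m 1 = to_ac (trace2 m (1 :: 'a))"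
    by (simp_all add: trace2_def to_ac_sum)
  then have tr: "trace2 m (1 / to_ac a) = trace2 m 1"
    by (simp only: assms(10))
  have a0': "to_ac a \<noteq> 0" and aq': "to_ac a ^ q = to_ac a"
    using a0 aq by (simp_all flip: to_ac_power)
  obtain R S :: "'a alg_closure" where RS: "R \<noteq> S" "R^3 + R = to_ac a" "S^3 + S = to_ac a"
    and RS_q: "if poly (map_poly of_bit (dickson_poly n)) (to_ac a) = 0 then R ^ q = R \<and> S ^ q = S
      else R ^ q = S \<and> S ^ q = R + S"
    by (rule cubic_roots_frobenius[OF ch' a0' assms(4) aq' tr assms(5)])
  have qadd: "(x + y) ^ q = x ^ q + y ^ q" for x y :: "'a alg_closure"
    unfolding assms(4) by (rule frobenius_add[OF ch'])
  have SRS: "S + (R + S) = R"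
    by (simp add: add.left_commute numeral_char2[OF ch'])
  have q3: "x ^ card (UNIV :: 'a set) = ((x ^ q) ^ q) ^ q" for x :: "'a alg_closure"
    by (simp add: assms(6) power3_eq_cube mult.assoc flip: power_mult)
  \<comment> \<open>The \<open>q\<close>-power map fixes the roots or rotates them; its cube fixes
    them in either case, so they descend to the given field.\<close>
  have "R ^ card (UNIV :: 'a set) = R" "S ^ card (UNIV :: 'a set) = S"
    using RS_q by (auto simp: q3 qadd SRS split: if_splits)
  then obtain r s where r: "R = to_ac r" and s: "S = to_ac s"
    using power_card_eq_imp_range_to_ac by blast
  have rs: "r \<noteq> s" "r^3 + r = a" "s^3 + s = a"
    using RS unfolding r s by (simp_all flip: to_ac_power to_ac_add)
  have rs_q: "if ?D = 0 then r ^ q = r \<and> s ^ q = s else r ^ q = s \<and> s ^ q = r + s"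
    using RS_q unfolding r s poly_of_bit_to_ac
    by (simp only: to_ac_eq_iff to_ac_eq_0_iff flip: to_ac_power to_ac_add)
  interpret rs: cubic_roots r s a j
    by unfold_locales (use ch a0 rs frob_cubed in auto)
  have pow_Suc: "x ^ (q ^ Suc k) = (x ^ (q ^ k)) ^ q" for x :: 'a and k
    by (simp add: mult.commute flip: power_mult)
  have "N = (if Suc j mod 3 = 0 then if ?D = 0 then 9 else 0 else 3)"
  proof (cases "?D = 0")
    case True
    then have "r ^ (q ^ k) = r" "s ^ (q ^ k) = s" for k
      using rs_q by (induction k) (simp_all add: pow_Suc del: power_Suc)
    then show ?thesis
      using rs.card_sol_split z True by (simp add: N frob)
  next
    case False
    then have rq: "r ^ q = s" and sq: "s ^ q = r + s"
      using rs_q by simp_all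
    have tq: "(r + s) ^ q = r"
      using frobenius_add[OF ch, of r s m]
      by (simp add: rq sq add.left_commute numeral_char2[OF ch] flip: assms(4))
    \<comment> \<open>Raising to the power \<open>q ^ l\<close> rotates the three roots by
      \<open>l mod 3\<close> places, which is not zero.\<close>
    have cycle: "r ^ (q ^ k) = (if k mod 3 = 0 then r else if k mod 3 = 1 then s else r + s)"
      "s ^ (q ^ k) = (if k mod 3 = 0 then s else if k mod 3 = 1 then r + s else r)" for k
      by (induction k) (auto simp: pow_Suc rq sq tq mod_Suc simp del: power_Suc)
    have "l mod 3 = 1 \<or> l mod 3 = 2"
      using assms(3) by presburger
    then show ?thesis
    proof
      assume "l mod 3 = 1"
      then show ?thesis
        using rs.card_sol_cyclic cycle[of l] z False by (simp add: N frob)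
    next
      assume l: "l mod 3 = 2"
      \<comment> \<open>The rotation by two places runs from \<open>r\<close> to
        \<open>r + s\<close> to \<open>s\<close>. The count for a cyclic permutation therefore
        applies with \<open>r + s\<close> as second root, and the third is
        \<open>r + (r + s) = s\<close>.\<close>
      interpret rt: cubic_roots r "r + s" a j
        by unfold_locales (use ch a0 rs frob_cubed rs.third_root rs.nonzero in auto)
      have "(r + s) ^ (2 ^ j) = s" "r + (r + s) = s"
        using l cycle[of l] frobenius_add[OF ch, of r s j]
        by (simp_all add: frob numeral_char2[OF ch] flip: add.assoc)
      then show ?thesis
        using rt.card_sol_cyclic cycle[of l] z False l by (simp add: N frob)
    qed
  qed
  then show ?thesis
    unfolding cong by auto
qed

end
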